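(* Let $n\ge 3$ and let a coherent system of sizes $(U,\mathcal{Y},\mathcal{I})$ be given, where $U$ is the set of models of a classical propositional language. Suppose the system satisfies $(\mathcal{I}_n)$: for all $X\in\mathcal{Y}$ and $A_1,\dots,A_n\in\mathcal{I}(X)$, $A_1\cup\dots\cup A_n\neq X$; and $(eM\mathcal{I})$: for all $X,Y\in\mathcal{Y}$ with $X\subseteq Y$, $\mathcal{I}(X)\subseteq\mathcal{I}(Y)$. Then the following hold: (1) $(\mathcal{M}^+_n)$: if $X_1\in\mathcal{F}(X_2),\ X_2\in\mathcal{F}(X_3),\dots,X_{n-1}\in\mathcal{F}(X_n)$, then $X_1\in\mathcal{M}^+(X_n)$. (2) $(CM_n)$: if $\alpha\mathrel{|\!\sim}\beta_1,\dots,\alpha\mathrel{|\!\sim}\beta_{n-1}$, then $\alpha\wedge\beta_1\wedge\dots\wedge\beta_{n-2}\mathrel{|\!\not\sim}\neg\beta_{n-1}$. (3) $(OR_n)$: if $\alpha_1\mathrel{|\!\sim}\beta,\dots,\alpha_{n-1}\mathrel{|\!\sim}\beta$, then $\alpha_1\vee\dots\vee\alpha_{n-1}\mathrel{|\!\not\sim}\neg\beta$.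
   Context: A coherent system of sizes consists of a set $U$ (the universe), a family $\mathcal{Y}\subseteq\mathcal{P}(U)$ with $\emptyset\notin\mathcal{Y}$, and for each $X\in\mathcal{Y}$ a family $\mathcal{I}(X)\subseteq\mathcal{P}(X)$ (the "small" subsets of $X$). Dually, $\mathcal{F}(X):=\{A\subseteq X: X-A\in\mathcal{I}(X)\}$ (the "big" subsets), and $\mathcal{M}^+(X):=\mathcal{P}(X)-\mathcal{I}(X)$ (the subsets that are not small). No further properties of $\mathcal{I}(X)$ are assumed unless stated. For propositional formulas, $M(\phi)\subseteq U$ is the set of models of $\phi$, and $\alpha\mathrel{|\!\sim}\beta$ means $M(\alpha\wedge\beta)\in\mathcal{F}(M(\alpha))$; $\mathrel{|\!\not\sim}$ is its negation. Convention: every rule is read as universally quantified over all sets, respectively formulas, such that each set $X$ at which $\mathcal{I}(X)$, $\mathcal{F}(X)$ or $\mathcal{M}^+(X)$ is evaluated (in particular $M(\alpha)$ for each $\alpha$ to the left of $\mathrel{|\!\sim}$ or $\mathrel{|\!\not\sim}$) belongs to $\mathcal{Y}$. *)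

theory Defs
  imports Main
begin

locale coherent_system =
  fixes U :: "'u set"
    and \<Y> :: "'u set set"
    and \<I> :: "'u set \<Rightarrow> 'u set set"
  assumes family_subset: "\<Y> \<subseteq> Pow U"
    and empty_notin: "{} \<notin> \<Y>"
    and small_subset: "X \<in> \<Y> \<Longrightarrow> \<I> X \<subseteq> Pow X"

text \<open>The values of \<open>\<I>\<close>, and hence of the two operators below, are meaningful only at sets in
  \<open>\<Y>\<close>; the rules carry the corresponding membership conditions explicitly.\<close>

definition big :: "('u set \<Rightarrow> 'u set set) \<Rightarrow> 'u set \<Rightarrow> 'u set set" where
  "big \<I> X = {A. A \<subseteq> X \<and> X - A \<in> \<I> X}"

definition not_small :: "('u set \<Rightarrow> 'u set set) \<Rightarrow> 'u set \<Rightarrow> 'u set set" where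
  "not_small \<I> X = Pow X - \<I> X"

datatype 'a form =
    Atom 'a
  | Bot
  | Neg "'a form"
  | And "'a form" "'a form"
  | Or "'a form" "'a form"
  | Imp "'a form" "'a form"

type_synonym 'a valuation = "'a \<Rightarrow> bool"

primrec sat :: "'a valuation \<Rightarrow> 'a form \<Rightarrow> bool" where
  "sat v (Atom p) \<longleftrightarrow> v p"
| "sat v Bot \<longleftrightarrow> False"
| "sat v (Neg \<phi>) \<longleftrightarrow> \<not> sat v \<phi>"
| "sat v (And \<phi> \<psi>) \<longleftrightarrow> sat v \<phi> \<and> sat v \<psi>"
| "sat v (Or \<phi> \<psi>) \<longleftrightarrow> sat v \<phi> \<or> sat v \<psi>"
| "sat v (Imp \<phi> \<psi>) \<longleftrightarrow> (sat v \<phi> \<longrightarrow> sat v \<psi>)"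

definition models :: "'a form \<Rightarrow> 'a valuation set" where
  "models \<phi> = {v. sat v \<phi>}"

definition nm_entails ::
  "('a valuation set \<Rightarrow> 'a valuation set set) \<Rightarrow> 'a form \<Rightarrow> 'a form \<Rightarrow> bool" where
  "nm_entails \<I> \<alpha> \<beta> \<longleftrightarrow> models (And \<alpha> \<beta>) \<in> big \<I> (models \<alpha>)"

definition rule_I :: "nat \<Rightarrow> 'u set set \<Rightarrow> ('u set \<Rightarrow> 'u set set) \<Rightarrow> bool" where
  "rule_I n \<Y> \<I> \<longleftrightarrow>
    (\<forall>X\<in>\<Y>. \<forall>A :: nat \<Rightarrow> 'u set. (\<forall>i\<in>{1..n}. A i \<in> \<I> X) \<longrightarrow> (\<Union>i\<in>{1..n}. A i) \<noteq> X)"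

definition rule_eMI :: "'u set set \<Rightarrow> ('u set \<Rightarrow> 'u set set) \<Rightarrow> bool" where
  "rule_eMI \<Y> \<I> \<longleftrightarrow> (\<forall>X\<in>\<Y>. \<forall>Y\<in>\<Y>. X \<subseteq> Y \<longrightarrow> \<I> X \<subseteq> \<I> Y)"

text \<open>In the next rule \<open>X 1\<close> is not required to be in \<open>\<Y>\<close>: neither operator is evaluated there.\<close>

definition rule_Mplus :: "nat \<Rightarrow> 'u set set \<Rightarrow> ('u set \<Rightarrow> 'u set set) \<Rightarrow> bool" where
  "rule_Mplus n \<Y> \<I> \<longleftrightarrow>
    (\<forall>X :: nat \<Rightarrow> 'u set.
      (\<forall>i\<in>{2..n}. X i \<in> \<Y>) \<longrightarrow>
      (\<forall>i\<in>{1..<n}. X i \<in> big \<I> (X (i + 1))) \<longrightarrow>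
      X 1 \<in> not_small \<I> (X n))"

text \<open>Iterated connectives associate to the left. For \<open>n \<ge> 3\<close> the two formulas below are
  \<open>\<alpha> \<and> \<beta>\<^sub>1 \<and> \<dots> \<and> \<beta>\<^bsub>n-2\<^esub>\<close> and \<open>\<alpha>\<^sub>1 \<or> \<dots> \<or> \<alpha>\<^bsub>n-1\<^esub>\<close>; recall that \<open>[i..<j]\<close> excludes \<open>j\<close>.\<close>

definition rule_CM ::
  "nat \<Rightarrow> 'a valuation set set \<Rightarrow> ('a valuation set \<Rightarrow> 'a valuation set set) \<Rightarrow> bool" where
  "rule_CM n \<Y> \<I> \<longleftrightarrow>
    (\<forall>(\<alpha> :: 'a form) (\<beta> :: nat \<Rightarrow> 'a form).
      let \<gamma> = foldl And \<alpha> (map \<beta> [1..<n-1]) in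
      models \<alpha> \<in> \<Y> \<longrightarrow> models \<gamma> \<in> \<Y> \<longrightarrow>
      (\<forall>i\<in>{1..n-1}. nm_entails \<I> \<alpha> (\<beta> i)) \<longrightarrow>
      \<not> nm_entails \<I> \<gamma> (Neg (\<beta> (n-1))))"

definition rule_OR ::
  "nat \<Rightarrow> 'a valuation set set \<Rightarrow> ('a valuation set \<Rightarrow> 'a valuation set set) \<Rightarrow> bool" where
  "rule_OR n \<Y> \<I> \<longleftrightarrow>
    (\<forall>(\<alpha> :: nat \<Rightarrow> 'a form) (\<beta> :: 'a form).
      let \<delta> = foldl Or (\<alpha> 1) (map \<alpha> [2..<n]) in
      (\<forall>i\<in>{1..n-1}. models (\<alpha> i) \<in> \<Y>) \<longrightarrow> models \<delta> \<in> \<Y> \<longrightarrow>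
      (\<forall>i\<in>{1..n-1}. nm_entails \<I> (\<alpha> i) \<beta>) \<longrightarrow>
      \<not> nm_entails \<I> \<delta> (Neg \<beta>))"

end

theory Submission imports Defs begin

text \<open>All three rules are the same covering argument. If the rule failed, the set that its
  conclusion is about would be the union of \<open>n\<close> sets: the \<open>n - 1\<close> exceptional sets provided by the
  premises and one more provided by the negated conclusion. Each of them is small in its own base
  set; that base set is contained in the largest one, so by \<open>rule_eMI\<close> all \<open>n\<close> are small in the
  largest one. This contradicts \<open>rule_I n\<close>. The covers are

    \<^item> for \<open>rule_Mplus\<close>: \<open>X n = X 1 \<union> (X 2 - X 1) \<union> \<dots> \<union> (X n - X (n-1))\<close>;
    \<^item> for \<open>rule_CM\<close>: a model of \<open>\<alpha>\<close> either violates some \<open>\<beta> i\<close> or satisfies all of them, and in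
      the latter case it is a model of \<open>\<gamma>\<close> violating \<open>\<not>\<beta> (n-1)\<close>;
    \<^item> for \<open>rule_OR\<close>: a model of the disjunction satisfies \<open>\<beta>\<close>, and thus violates \<open>\<not>\<beta>\<close>, or it is a
      model of some \<open>\<alpha> i\<close> violating \<open>\<beta>\<close>.\<close>

text \<open>The form in which \<open>rule_I\<close> is used: the extra set \<open>C\<close> is the one that comes from the
  negated conclusion of a rule.\<close>

lemma rule_I_no_cover:
  assumes "rule_I n \<Y> \<I>" and "n \<ge> 1" and "X \<in> \<Y>"
    and B: "\<And>i. i \<in> {1..n-1} \<Longrightarrow> B i \<in> \<I> X" and C: "C \<in> \<I> X"
  shows "(\<Union>i\<in>{1..n-1}. B i) \<union> C \<noteq> X"
proof -
  let ?A = "B(n := C)"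
  have split: "{1..n} = insert n {1..n-1}"
    using \<open>n \<ge> 1\<close> by auto
  have "\<forall>i\<in>{1..n}. ?A i \<in> \<I> X"
    using B C by auto
  then have "(\<Union>i\<in>{1..n}. ?A i) \<noteq> X"
    using assms(1,3) unfolding rule_I_def by blast
  moreover have "(\<Union>i\<in>{1..n}. ?A i) = (\<Union>i\<in>{1..n-1}. B i) \<union> C"
    using \<open>n \<ge> 1\<close> unfolding split by auto
  ultimately show ?thesis
    by simp
qed

lemma small_mono:
  assumes "rule_eMI \<Y> \<I>" "X \<in> \<Y>" "Y \<in> \<Y>" "X \<subseteq> Y" "A \<in> \<I> X"
  shows "A \<in> \<I> Y"
  using assms unfolding rule_eMI_def by blast

lemma nm_entails_iff:
  "nm_entails \<I> \<alpha> \<beta> \<longleftrightarrow> models \<alpha> - models \<beta> \<in> \<I> (models \<alpha>)"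
proof -
  have "models (And \<alpha> \<beta>) = models \<alpha> \<inter> models \<beta>"
    by (auto simp: models_def)
  then show ?thesis
    by (simp add: nm_entails_def big_def Diff_Int)
qed

lemma models_Neg: "models (Neg \<phi>) = - models \<phi>"
  by (auto simp: models_def)

lemma models_foldl_And:
  "models (foldl And \<alpha> \<phi>s) = models \<alpha> \<inter> (\<Inter>\<phi>\<in>set \<phi>s. models \<phi>)"
  by (induction \<phi>s arbitrary: \<alpha>) (auto simp: models_def)

lemma models_foldl_Or:
  "models (foldl Or \<alpha> \<phi>s) = models \<alpha> \<union> (\<Union>\<phi>\<in>set \<phi>s. models \<phi>)"
  by (induction \<phi>s arbitrary: \<alpha>) (auto simp: models_def)

lemma chain_subset_increments:
  assumes "1 \<le> (n::nat)"
  shows "X n \<subseteq> X 1 \<union> (\<Union>i\<in>{1..<n}. X (i + 1) - X i)"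
  using assms
proof (induction n rule: dec_induct)
  case base
  then show ?case by simp
next
  case (step n)
  have "X (Suc n) \<subseteq> X n \<union> (X (Suc n) - X n)"
    by blast
  then show ?case
    using step by (auto simp: atLeastLessThanSuc)
qed

lemma rule_Mplus_if_rule_I:
  assumes "rule_I n \<Y> \<I>" and eMI: "rule_eMI \<Y> \<I>" and n: "n \<ge> 2"
  shows "rule_Mplus n \<Y> \<I>"
  unfolding rule_Mplus_def
proof (intro allI impI)
  fix X :: "nat \<Rightarrow> 'a set"
  assume Y: "\<forall>i\<in>{2..n}. X i \<in> \<Y>" and chain: "\<forall>i\<in>{1..<n}. X i \<in> big \<I> (X (i + 1))"
  have sub: "X i \<subseteq> X n" if "1 \<le> i" "i \<le> n" for i
    using \<open>i \<le> n\<close> \<open>1 \<le> i\<close>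
  proof (induction i rule: inc_induct)
    case base
    then show ?case by simp
  next
    case (step m)
    then have "X m \<subseteq> X (Suc m)"
      using chain by (auto simp: big_def)
    with step show ?case by auto
  qed
  have incr: "X (i + 1) - X i \<in> \<I> (X n)" if "i \<in> {1..n-1}" for i
  proof (rule small_mono[OF eMI])
    show "X (i + 1) \<in> \<Y>" "X n \<in> \<Y>"
      using Y that n by auto
    show "X (i + 1) \<subseteq> X n"
      by (rule sub) (use that n in auto)
    show "X (i + 1) - X i \<in> \<I> (X (i + 1))"
      using chain that by (auto simp: big_def)
  qed
  have "X 1 \<notin> \<I> (X n)"
  proof
    assume "X 1 \<in> \<I> (X n)"
    moreover have "X n \<in> \<Y>" "n \<ge> 1"
      using Y n by auto
    ultimately have "(\<Union>i\<in>{1..n-1}. X (i + 1) - X i) \<union> X 1 \<noteq> X n"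
      using rule_I_no_cover[OF assms(1), where B = "\<lambda>i. X (i + 1) - X i"] incr by blast
    moreover have "{1..n-1} = {1..<n}"
      using n by auto
    then have "X n \<subseteq> (\<Union>i\<in>{1..n-1}. X (i + 1) - X i) \<union> X 1"
      using chain_subset_increments[of n X] n by (simp add: Un_commute)
    moreover have "(\<Union>i\<in>{1..n-1}. X (i + 1) - X i) \<union> X 1 \<subseteq> X n"
    proof -
      have "X (i + 1) \<subseteq> X n" if "i \<in> {1..n-1}" for i
        by (rule sub) (use that n in auto)
      moreover have "X 1 \<subseteq> X n"
        using sub n by auto
      ultimately show ?thesis by blast
    qed
    ultimately show False by blast
  qed
  moreover have "X 1 \<subseteq> X n"
    using sub n by auto
  ultimately show "X 1 \<in> not_small \<I> (X n)"
    by (simp add: not_small_def)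
qed

lemma rule_CM_if_rule_I:
  assumes "rule_I n \<Y> \<I>" and eMI: "rule_eMI \<Y> \<I>" and n: "n \<ge> 2"
  shows "rule_CM n \<Y> \<I>"
  unfolding rule_CM_def Let_def
proof (intro allI impI notI)
  fix \<alpha> :: "'a form" and \<beta> :: "nat \<Rightarrow> 'a form"
  let ?\<gamma> = "foldl And \<alpha> (map \<beta> [1..<n-1])"
  assume Y: "models \<alpha> \<in> \<Y>" "models ?\<gamma> \<in> \<Y>"
    and ent: "\<forall>i\<in>{1..n-1}. nm_entails \<I> \<alpha> (\<beta> i)"
    and neg: "nm_entails \<I> ?\<gamma> (Neg (\<beta> (n-1)))"
  have \<gamma>: "models ?\<gamma> = models \<alpha> \<inter> (\<Inter>i\<in>{1..<n-1}. models (\<beta> i))"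
    by (simp add: models_foldl_And)
  let ?C = "models ?\<gamma> \<inter> models (\<beta> (n-1))"
  have "?C \<in> \<I> (models ?\<gamma>)"
    using neg by (simp add: nm_entails_iff models_Neg Diff_eq)
  then have "?C \<in> \<I> (models \<alpha>)"
    using small_mono[OF eMI Y(2,1)] \<gamma> by blast
  moreover have "models \<alpha> - models (\<beta> i) \<in> \<I> (models \<alpha>)" if "i \<in> {1..n-1}" for i
    using ent that by (simp add: nm_entails_iff)
  ultimately have "(\<Union>i\<in>{1..n-1}. models \<alpha> - models (\<beta> i)) \<union> ?C \<noteq> models \<alpha>"
    using rule_I_no_cover[OF assms(1) _ Y(1), where B = "\<lambda>i. models \<alpha> - models (\<beta> i)"] n by auto
  moreover have "{1..n-1} = insert (n-1) {1..<n-1}"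
    using n by auto
  then have "(\<Union>i\<in>{1..n-1}. models \<alpha> - models (\<beta> i)) \<union> ?C = models \<alpha>"
    unfolding \<gamma> by auto
  ultimately show False by contradiction
qed

lemma rule_OR_if_rule_I:
  assumes "rule_I n \<Y> \<I>" and eMI: "rule_eMI \<Y> \<I>" and n: "n \<ge> 2"
  shows "rule_OR n \<Y> \<I>"
  unfolding rule_OR_def Let_def
proof (intro allI impI notI)
  fix \<alpha> :: "nat \<Rightarrow> 'a form" and \<beta> :: "'a form"
  let ?\<delta> = "foldl Or (\<alpha> 1) (map \<alpha> [2..<n])"
  assume Y: "\<forall>i\<in>{1..n-1}. models (\<alpha> i) \<in> \<Y>" "models ?\<delta> \<in> \<Y>"
    and ent: "\<forall>i\<in>{1..n-1}. nm_entails \<I> (\<alpha> i) \<beta>"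
    and neg: "nm_entails \<I> ?\<delta> (Neg \<beta>)"
  have "{1..n-1} = insert 1 {2..<n}"
    using n by auto
  then have \<delta>: "models ?\<delta> = (\<Union>i\<in>{1..n-1}. models (\<alpha> i))"
    by (simp add: models_foldl_Or)
  have "models (\<alpha> i) - models \<beta> \<in> \<I> (models ?\<delta>)" if i: "i \<in> {1..n-1}" for i
  proof (rule small_mono[OF eMI _ Y(2)])
    show "models (\<alpha> i) \<in> \<Y>"
      using Y(1) i by blast
    show "models (\<alpha> i) \<subseteq> models ?\<delta>"
      using \<delta> i by blast
    show "models (\<alpha> i) - models \<beta> \<in> \<I> (models (\<alpha> i))"
      using ent i by (simp add: nm_entails_iff)
  qed
  moreover have "models ?\<delta> \<inter> models \<beta> \<in> \<I> (models ?\<delta>)"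
    using neg by (simp add: nm_entails_iff models_Neg Diff_eq)
  ultimately have
    "(\<Union>i\<in>{1..n-1}. models (\<alpha> i) - models \<beta>) \<union> (models ?\<delta> \<inter> models \<beta>) \<noteq> models ?\<delta>"
    using rule_I_no_cover[OF assms(1) _ Y(2), where B = "\<lambda>i. models (\<alpha> i) - models \<beta>"] n by auto
  moreover have
    "(\<Union>i\<in>{1..n-1}. models (\<alpha> i) - models \<beta>) \<union> (models ?\<delta> \<inter> models \<beta>) = models ?\<delta>"
    unfolding \<delta> by blast
  ultimately show False by contradiction
qed

theorem fact3p6:
  fixes n :: nat
    and \<Y> :: "'a valuation set set"
    and \<I> :: "'a valuation set \<Rightarrow> 'a valuation set set"
  assumes "n \<ge> 3"
    and "coherent_system (UNIV :: 'a valuation set) \<Y> \<I>"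
    and "rule_I n \<Y> \<I>"
    and "rule_eMI \<Y> \<I>"
  shows "rule_Mplus n \<Y> \<I> \<and> rule_CM n \<Y> \<I> \<and> rule_OR n \<Y> \<I>"
proof -
  have "n \<ge> 2"
    using assms(1) by simp
  then show ?thesis
    using assms(3,4) by (intro conjI rule_Mplus_if_rule_I rule_CM_if_rule_I rule_OR_if_rule_I)
qed

end
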